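(* Let $X$ be a proper metric space and let $\mathcal{A}=\{A_1,\dots,A_n\}\subset H(X)$ be a nonempty finite set. Then $\Sigma(\mathcal{A})$ and $\Omega(\mathcal{A})$ are not empty. Moreover, for any $d\in\Omega(\mathcal{A})$, the set $K_d(\mathcal{A})$ is the unique maximal Steiner compact in $\Sigma_d(\mathcal{A})$, and a compact set $K\subset X$ belongs to $\Sigma_d(\mathcal{A})$ if and only if $K_\lambda\subset K\subset K_d(\mathcal{A})$ for some minimal Steiner compact $K_\lambda\in\Sigma_d(\mathcal{A})$.
   Context: A metric space is proper if every closed bounded subset of it is compact. For a metric space $(X,\rho)$, $H(X)$ denotes the set of all nonempty compact subsets of $X$ endowed with the Hausdorff distance $d_H$. For $A\subset X$ and $r\ge 0$, $B_r^X(A)=\{x\in X:\rho(x,A)\le r\}$, where $\rho(x,A)=\inf_{a\in A}\rho(x,a)$. For $\mathcal{A}=\{A_1,\dots,A_n\}\subset H(X)$ and $K\in H(X)$ put $S_{\mathcal{A}}(K)=\sum_{i=1}^n d_H(K,A_i)$. $\Sigma(\mathcal{A})$ is the set of all $K\in H(X)$ at which $S_{\mathcal{A}}$ attains its minimum over $H(X)$; its elements are called Steiner compacts. $\Omega(\mathcal{A})=\{(d_H(K,A_1),\dots,d_H(K,A_n)):K\in\Sigma(\mathcal{A})\}$, and for $d=(d_1,\dots,d_n)\in\Omega(\mathcal{A})$, $\Sigma_d(\mathcal{A})=\{K\in\Sigma(\mathcal{A}): d_H(K,A_i)=d_i \text{ for all } i\}$. A minimal (respectively, maximal) Steiner compact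 in $\Sigma_d(\mathcal{A})$ is a minimal (respectively, maximal) element of $\Sigma_d(\mathcal{A})$ with respect to inclusion. For a vector $d=(d_1,\dots,d_n)$ with nonnegative components, $K_d(\mathcal{A})=\bigcap_{i=1}^n B_{d_i}^X(A_i)$. *)

theory Defs
  imports "HOL-Analysis.Analysis"
begin

definition compacts :: "'a::metric_space set set"
  where "compacts = {K. K \<noteq> {} \<and> compact K}"

definition closed_nbhd :: "real \<Rightarrow> 'a::metric_space set \<Rightarrow> 'a set"
  where "closed_nbhd r A = {x. infdist x A \<le> r}"

definition hausdorff_dist :: "'a::metric_space set \<Rightarrow> 'a set \<Rightarrow> real"
  where "hausdorff_dist A B =
    Inf {r. 0 \<le> r \<and> A \<subseteq> closed_nbhd r B \<and> B \<subseteq> closed_nbhd r A}"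

text \<open>The finite set \<open>{A\<^sub>1, \<dots>, A\<^sub>n}\<close> is given by a family indexed by a finite type \<open>'n\<close>
  (so \<open>n = CARD('n) \<ge> 1\<close>); the vectors of distances live in \<open>real ^ 'n\<close>.\<close>

definition dist_sum :: "('n::finite \<Rightarrow> 'a::metric_space set) \<Rightarrow> 'a set \<Rightarrow> real"
  where "dist_sum A K = (\<Sum>i\<in>UNIV. hausdorff_dist K (A i))"

definition steiner_compacts :: "('n::finite \<Rightarrow> 'a::metric_space set) \<Rightarrow> 'a set set"
  where "steiner_compacts A = {K \<in> compacts. \<forall>L\<in>compacts. dist_sum A K \<le> dist_sum A L}"

definition steiner_vectors :: "('n::finite \<Rightarrow> 'a::metric_space set) \<Rightarrow> (real ^ 'n) set"
  where "steiner_vectors A = (\<lambda>K. \<chi> i. hausdorff_dist K (A i)) ` steiner_compacts A"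

definition steiner_class ::
    "('n::finite \<Rightarrow> 'a::metric_space set) \<Rightarrow> real ^ 'n \<Rightarrow> 'a set set"
  where "steiner_class A d = {K \<in> steiner_compacts A. \<forall>i. hausdorff_dist K (A i) = d $ i}"

definition minimal_steiner ::
    "('n::finite \<Rightarrow> 'a::metric_space set) \<Rightarrow> real ^ 'n \<Rightarrow> 'a set \<Rightarrow> bool"
  where "minimal_steiner A d K \<longleftrightarrow>
    K \<in> steiner_class A d \<and> (\<forall>L\<in>steiner_class A d. L \<subseteq> K \<longrightarrow> L = K)"

definition maximal_steiner ::
    "('n::finite \<Rightarrow> 'a::metric_space set) \<Rightarrow> real ^ 'n \<Rightarrow> 'a set \<Rightarrow> bool"
  where "maximal_steiner A d K \<longleftrightarrow>
    K \<in> steiner_class A d \<and> (\<forall>L\<in>steiner_class A d. K \<subseteq> L \<longrightarrow> L = K)"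

definition nbhd_inter ::
    "('n::finite \<Rightarrow> 'a::metric_space set) \<Rightarrow> real ^ 'n \<Rightarrow> 'a set"
  where "nbhd_inter A d = (\<Inter>i. closed_nbhd (d $ i) (A i))"

end

theory Submission
  imports Defs
begin

text \<open>For a vector \<open>d\<close>, let \<open>W\<close> be the family of nonempty compact sets \<open>K\<close> whose Hausdorff distance
  to each \<open>A i\<close> is at most \<open>d $ i\<close> (\<open>compacts_within\<close>). Such a bound splits into two inclusions:
  \<open>K\<close> lies in the \<open>d $ i\<close>-neighbourhood of \<open>A i\<close>, for all \<open>i\<close> together \<open>K \<subseteq> nbhd_inter A d\<close>;
  and \<open>A i\<close> lies in the \<open>d $ i\<close>-neighbourhood of \<open>K\<close>, a property that passes to larger sets. Hence
  \<open>W\<close> is closed under enlarging inside \<open>nbhd_inter A d\<close>, and when \<open>W\<close> is nonempty that intersection,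
  compact because the space is proper, is its largest element.

  Existence follows from this. Because only one candidate set has to be tested, \<open>W\<close> is nonempty iff every point of every \<open>A i\<close> has a point of
  \<open>nbhd_inter A d\<close> at distance at most \<open>d $ i\<close>
  (\<open>compacts_within_nonempty_iff\<close>). Such nearby points stay bounded when \<open>d\<close> varies in a convergent
  sequence, so they have a limit point, and the set of \<open>d\<close> with \<open>W\<close> nonempty is closed
  (\<open>closed_solvable_bounds\<close>). On this set the sum of the entries has a minimum, and any member of the
  corresponding \<open>W\<close> is a Steiner compact.

  If \<open>d\<close> is the distance vector of a Steiner compact, minimality of the sum forces every bound
  defining \<open>W\<close> to be an equality, so \<open>W\<close> is exactly the Steiner class of \<open>d\<close>
  (\<open>steiner_class_eq_compacts_within\<close>). The statements about the maximal element and the interval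
  structure are then those about \<open>W\<close>. The minimal elements come from Zorn's lemma, since by compactness
  \<open>W\<close> is closed under intersections of nonempty chains (\<open>compacts_within_Inter_chain\<close>).\<close>

section \<open>Closed neighbourhoods and the Hausdorff distance\<close>

lemma mem_compactsD:
  assumes "K \<in> compacts"
  shows "K \<noteq> {}" "compact K" "closed K" "bounded K"
  using assms by (auto simp: compacts_def compact_imp_closed compact_imp_bounded)

lemma closed_closed_nbhd: "closed (closed_nbhd r S)"
  unfolding closed_nbhd_def by (intro closed_Collect_le continuous_intros)

lemma mem_closed_nbhd_compact:
  assumes "K \<in> compacts"
  shows "x \<in> closed_nbhd r K \<longleftrightarrow> (\<exists>k\<in>K. dist x k \<le> r)"
proof
  assume x: "x \<in> closed_nbhd r K"
  obtain k where k: "k \<in> K" "\<And>y. y \<in> K \<Longrightarrow> dist x k \<le> dist x y"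
    using continuous_attains_inf[of K "dist x"] mem_compactsD(1,2)[OF assms]
      continuous_on_dist[OF continuous_on_const continuous_on_id] by blast
  have "dist x k \<le> infdist x K"
    using k mem_compactsD(1)[OF assms] by (auto simp: infdist_def intro!: cINF_greatest)
  with x k show "\<exists>k\<in>K. dist x k \<le> r"
    by (force simp: closed_nbhd_def)
qed (auto simp: closed_nbhd_def intro: infdist_le2)

lemma bounded_closed_nbhd:
  assumes "K \<in> compacts"
  shows "bounded (closed_nbhd r K)"
proof -
  obtain c R where K: "\<And>y. y \<in> K \<Longrightarrow> dist c y \<le> R"
    using mem_compactsD(4)[OF assms] by (auto simp: bounded_def)
  have "dist c x \<le> R + r" if x: "x \<in> closed_nbhd r K" for x
  proof -
    obtain k where "k \<in> K" "dist x k \<le> r"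
      using x mem_closed_nbhd_compact[OF assms] by auto
    then show ?thesis
      using K[of k] dist_triangle2[of c x k] by linarith
  qed
  then show ?thesis by (auto simp: bounded_def)
qed

lemma bounded_subset_closed_nbhd:
  assumes "bounded S" "T \<noteq> {}"
  shows "\<exists>r\<ge>0. S \<subseteq> closed_nbhd r T"
proof -
  obtain t where t: "t \<in> T" using assms by blast
  obtain R where R: "\<And>y. y \<in> S \<Longrightarrow> dist t y \<le> R"
    using assms(1) by (meson bounded_any_center)
  have "S \<subseteq> closed_nbhd (max 0 R) T"
    using t R by (auto simp: closed_nbhd_def dist_commute intro!: infdist_le2[of t] max.coboundedI2)
  then show ?thesis by (metis max.cobounded1)
qed

lemma closed_nbhd_mono: "r \<le> s \<Longrightarrow> closed_nbhd r S \<subseteq> closed_nbhd s S"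
  by (auto simp: closed_nbhd_def)

text \<open>The infimum defining the Hausdorff distance is attained, because the admissible radii form a
  closed set; this turns a bound on the distance into two inclusions.\<close>

lemma hausdorff_dist_le_iff:
  assumes "K \<in> compacts" "L \<in> compacts"
  shows "hausdorff_dist K L \<le> r \<longleftrightarrow> K \<subseteq> closed_nbhd r L \<and> L \<subseteq> closed_nbhd r K"
proof -
  define R where "R = {r. 0 \<le> r \<and> K \<subseteq> closed_nbhd r L \<and> L \<subseteq> closed_nbhd r K}"
  have hd: "hausdorff_dist K L = Inf R" by (simp add: hausdorff_dist_def R_def)
  have "R = {0..} \<inter> (\<Inter>x\<in>K. {infdist x L..}) \<inter> (\<Inter>x\<in>L. {infdist x K..})"
    by (auto simp: R_def closed_nbhd_def)
  then have "closed R" by auto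
  have bdd: "bdd_below R" by (auto simp: R_def bdd_below_def)
  obtain r1 r2 where "r1 \<ge> 0" "K \<subseteq> closed_nbhd r1 L" "r2 \<ge> 0" "L \<subseteq> closed_nbhd r2 K"
    using bounded_subset_closed_nbhd mem_compactsD assms by metis
  then have "max r1 r2 \<in> R"
    using closed_nbhd_mono[of r1 "max r1 r2" L] closed_nbhd_mono[of r2 "max r1 r2" K]
    by (auto simp: R_def)
  then have Inf: "Inf R \<in> R"
    using closed_contains_Inf[OF _ bdd \<open>closed R\<close>] by auto
  have "r \<ge> 0" if "K \<subseteq> closed_nbhd r L"
  proof -
    obtain x where "x \<in> K" using mem_compactsD(1)[OF assms(1)] by blast
    with that have "infdist x L \<le> r" by (auto simp: closed_nbhd_def)
    then show ?thesis using infdist_nonneg[of x L] by linarith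
  qed
  then have "r \<in> R" if "K \<subseteq> closed_nbhd r L" "L \<subseteq> closed_nbhd r K"
    using that by (auto simp: R_def)
  then show ?thesis
    using Inf cInf_lower[OF _ bdd]
    unfolding hd by (fastforce simp: R_def dest: closed_nbhd_mono)
qed

lemma hausdorff_dist_nonneg:
  assumes "K \<in> compacts" "L \<in> compacts"
  shows "0 \<le> hausdorff_dist K L"
proof -
  obtain x where "x \<in> K" using mem_compactsD(1)[OF assms(1)] by blast
  then have "infdist x L \<le> hausdorff_dist K L"
    using hausdorff_dist_le_iff[OF assms, of "hausdorff_dist K L"] by (auto simp: closed_nbhd_def)
  then show ?thesis using infdist_nonneg[of x L] by linarith
qed

section \<open>Compact sets within given distances\<close>

definition compacts_within ::
    "('n::finite \<Rightarrow> 'a::metric_space set) \<Rightarrow> real ^ 'n \<Rightarrow> 'a set set"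
  where "compacts_within A d = {K \<in> compacts. \<forall>i. hausdorff_dist K (A i) \<le> d $ i}"

locale compact_family =
  fixes A :: "'n::finite \<Rightarrow> 'a::metric_space set"
  assumes member_compacts: "A i \<in> compacts"

locale proper_compact_family = compact_family A
  for A :: "'n::finite \<Rightarrow> 'a::metric_space set" +
  assumes proper: "closed (S :: 'a set) \<Longrightarrow> bounded S \<Longrightarrow> compact S"

text \<open>Of the two inclusions for each \<open>i\<close>, the first kind bounds \<open>K\<close> from above by a fixed set, and the
  second kind is monotone in \<open>K\<close>; the arguments on enlarging and shrinking members all start here.\<close>

lemma (in compact_family) mem_compacts_within_iff:
  shows "K \<in> compacts_within A d \<longleftrightarrow>
    K \<in> compacts \<and> K \<subseteq> nbhd_inter A d \<and> (\<forall>i. A i \<subseteq> closed_nbhd (d $ i) K)"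
  using hausdorff_dist_le_iff member_compacts by (fastforce simp: compacts_within_def nbhd_inter_def)

lemma (in compact_family) compacts_within_enlarge:
  assumes "K \<in> compacts_within A d"
    and "K \<subseteq> L" "L \<subseteq> nbhd_inter A d" "compact L"
  shows "L \<in> compacts_within A d"
proof -
  have K: "K \<in> compacts" "\<And>i. A i \<subseteq> closed_nbhd (d $ i) K"
    using assms(1) mem_compacts_within_iff by auto
  have L: "L \<in> compacts" using K(1) assms(2,4) by (auto simp: compacts_def)
  have "closed_nbhd r K \<subseteq> closed_nbhd r L" for r
    using assms(2) mem_closed_nbhd_compact K(1) L by blast
  then show ?thesis
    using K L assms(3) mem_compacts_within_iff by blast
qed

lemma (in proper_compact_family) compact_nbhd_inter:
  shows "compact (nbhd_inter A d)"
proof (rule proper)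
  show "closed (nbhd_inter A d)"
    by (auto simp: nbhd_inter_def intro: closed_closed_nbhd)
  have "nbhd_inter A d \<subseteq> closed_nbhd (d $ undefined) (A undefined)"
    by (auto simp: nbhd_inter_def)
  then show "bounded (nbhd_inter A d)"
    using bounded_closed_nbhd[OF member_compacts] bounded_subset by blast
qed

text \<open>Every solution of the system of bounds may be enlarged to \<open>nbhd_inter A d\<close>, so only this set
  has to be tested, one point of \<open>A i\<close> at a time. The right-hand side quantifies over points
  instead of compact sets, which is what makes the passage to the limit in \<open>d\<close> easy.\<close>

lemma (in proper_compact_family) compacts_within_nonempty_iff:
  shows "compacts_within A d \<noteq> {} \<longleftrightarrow>
    (\<forall>i. \<forall>a\<in>A i. \<exists>k\<in>nbhd_inter A d. dist a k \<le> d $ i)" (is "_ \<longleftrightarrow> ?R")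
proof
  assume "compacts_within A d \<noteq> {}"
  then obtain K where K: "K \<in> compacts" "K \<subseteq> nbhd_inter A d" "\<And>i. A i \<subseteq> closed_nbhd (d $ i) K"
    using mem_compacts_within_iff by blast
  then show ?R
    using mem_closed_nbhd_compact[OF K(1)] by blast
next
  assume R: ?R
  \<comment> \<open>The index type is nonempty, so some \<open>A i\<close> has a point, and the assumption yields a point near it.\<close>
  obtain a where "a \<in> A undefined" using mem_compactsD(1)[OF member_compacts] by blast
  with R have "nbhd_inter A d \<noteq> {}" by blast
  then have top: "nbhd_inter A d \<in> compacts"
    using compact_nbhd_inter by (simp add: compacts_def)
  then have "nbhd_inter A d \<in> compacts_within A d"
    using R by (auto simp: mem_compacts_within_iff mem_closed_nbhd_compact top)
  then show "compacts_within A d \<noteq> {}" by blast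
qed

section \<open>Existence of Steiner compacts\<close>

text \<open>For a fixed point of \<open>A i\<close>, the nearby points provided by a convergent sequence of solvable
  bounds remain in one closed ball, compact by properness; a limit point satisfies all the limiting
  inequalities because distances to a point and to a set are continuous.\<close>

lemma (in proper_compact_family) closed_solvable_bounds:
  shows "closed {d. compacts_within A d \<noteq> {}}"
  unfolding closed_sequential_limits
proof (intro allI impI, elim conjE)
  fix e :: "nat \<Rightarrow> real ^ 'n" and d
  assume e: "\<forall>n. e n \<in> {d. compacts_within A d \<noteq> {}}" and lim: "e \<longlonglongrightarrow> d"
  have lim_i: "(\<lambda>n. e n $ i) \<longlonglongrightarrow> d $ i" for i
    by (rule tendsto_vec_nth[OF lim])
  have "\<exists>k\<in>nbhd_inter A d. dist a k \<le> d $ i" if a: "a \<in> A i" for i a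
  proof -
    have "\<exists>k\<in>nbhd_inter A (e n). dist a k \<le> e n $ i" for n
      using e a compacts_within_nonempty_iff by blast
    then obtain k where k: "\<And>n. k n \<in> nbhd_inter A (e n)" "\<And>n. dist a (k n) \<le> e n $ i"
      by metis
    obtain B where B: "\<And>n. e n $ i \<le> B"
      using convergent_imp_Bseq[OF convergentI[OF lim_i]] by (metis Bseq_def abs_le_D1 real_norm_def)
    have "k n \<in> cball a B" for n using k(2)[of n] B[of n] by simp
    moreover have "compact (cball a B)" by (intro proper) auto
    ultimately obtain l s where s: "strict_mono s" "(k \<circ> s) \<longlonglongrightarrow> l"
      by (metis compact_imp_seq_compact seq_compactE)
    have sub: "(\<lambda>n. e (s n) $ j) \<longlonglongrightarrow> d $ j" for j
      using LIMSEQ_subseq_LIMSEQ[OF lim_i s(1)] by (simp add: o_def)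
    have ks: "(\<lambda>n. k (s n)) \<longlonglongrightarrow> l" using s(2) by (simp add: o_def)
    have "infdist l (A j) \<le> d $ j" for j
      using k(1) by (intro LIMSEQ_le[OF tendsto_infdist[OF ks] sub])
        (auto simp: nbhd_inter_def closed_nbhd_def)
    moreover have "dist a l \<le> d $ i"
      using k(2) by (intro LIMSEQ_le[OF tendsto_dist[OF tendsto_const ks] sub]) auto
    ultimately show ?thesis by (auto simp: nbhd_inter_def closed_nbhd_def)
  qed
  then show "d \<in> {d. compacts_within A d \<noteq> {}}"
    using compacts_within_nonempty_iff by blast
qed

text \<open>The minimization takes place in the finite-dimensional space of vectors instead of the
  space of compact sets: a solvable \<open>d\<close> with least sum of entries bounds the distances of some
  compact set, and the distance vector of any competitor is itself solvable.\<close>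

lemma (in proper_compact_family) steiner_compacts_nonempty:
  shows "steiner_compacts A \<noteq> {}"
proof -
  define v where "v K = (\<chi> i. hausdorff_dist K (A i))" for K :: "'a set"
  have sum_v: "dist_sum A K = (\<Sum>i\<in>UNIV. v K $ i)" for K
    by (simp add: v_def dist_sum_def)
  \<comment> \<open>The total distance of one admissible set serves as cutoff, making the vectors bounded.\<close>
  define s where "s = dist_sum A (A undefined)"
  define F where "F = {d. compacts_within A d \<noteq> {}} \<inter> {d. (\<Sum>i\<in>UNIV. d $ i) \<le> s}"
  have v_F: "v K \<in> F" if "K \<in> compacts" "dist_sum A K \<le> s" for K
    using that sum_v[of K] by (auto simp: F_def compacts_within_def v_def)
  have nonneg: "0 \<le> d $ i" if "d \<in> F" for d i
    using that hausdorff_dist_nonneg[OF _ member_compacts] by (force simp: F_def compacts_within_def intro: order_trans)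
  have "d \<in> cbox 0 (\<chi> i. s)" if d: "d \<in> F" for d
  proof -
    have "d $ i \<le> s" for i
      using member_le_sum[of i UNIV "\<lambda>i. d $ i"] nonneg[OF d] d by (force simp: F_def)
    then show ?thesis using nonneg[OF d] by (simp add: mem_box_cart)
  qed
  then have "bounded F" by (meson bounded_cbox bounded_subset subsetI)
  moreover have "closed F"
    unfolding F_def by (intro closed_Int closed_solvable_bounds closed_Collect_le continuous_intros)
  ultimately have "compact F" by (simp add: compact_eq_bounded_closed)
  moreover have "v (A undefined) \<in> F" using member_compacts by (intro v_F) (simp_all add: s_def)
  moreover have "continuous_on F (\<lambda>d. \<Sum>i\<in>UNIV. d $ i)"
    by (intro continuous_intros)
  ultimately obtain d where d: "d \<in> F" "\<And>e. e \<in> F \<Longrightarrow> (\<Sum>i\<in>UNIV. d $ i) \<le> (\<Sum>i\<in>UNIV. e $ i)"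
    using continuous_attains_inf[of F "\<lambda>d. \<Sum>i\<in>UNIV. d $ i"]
    by blast
  then obtain K where K: "K \<in> compacts" "\<And>i. hausdorff_dist K (A i) \<le> d $ i"
    by (auto simp: F_def compacts_within_def)
  have Kd: "dist_sum A K \<le> (\<Sum>i\<in>UNIV. d $ i)"
    unfolding dist_sum_def by (intro sum_mono K)
  have "dist_sum A K \<le> dist_sum A L" if L: "L \<in> compacts" for L
  proof (cases "dist_sum A L \<le> s")
    case True
    then show ?thesis using Kd d(2)[OF v_F[OF L]] sum_v[of L] by simp
  next
    case False
    then show ?thesis using Kd d(1) by (simp add: F_def)
  qed
  then show ?thesis using K(1) by (auto simp: steiner_compacts_def)
qed

section \<open>The structure of a Steiner class\<close>

text \<open>The minimal total distance is the sum of the entries of a Steiner vector. A compact set that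
  stays below this vector in each entry therefore cannot be strictly below it in any.\<close>

lemma steiner_class_eq_compacts_within:
  assumes "d \<in> steiner_vectors A"
  shows "steiner_class A d = compacts_within A d"
proof -
  obtain K where K: "K \<in> steiner_compacts A" "\<And>i. d $ i = hausdorff_dist K (A i)"
    using assms by (auto simp: steiner_vectors_def)
  have "L \<in> steiner_class A d" if L: "L \<in> compacts_within A d" for L
  proof -
    have le: "hausdorff_dist L (A i) \<le> hausdorff_dist K (A i)" for i
      using L K(2) by (auto simp: compacts_within_def)
    have "L \<in> compacts" using L by (simp add: compacts_within_def)
    then have "dist_sum A K \<le> dist_sum A L" using K(1) by (simp add: steiner_compacts_def)
    moreover have "dist_sum A L \<le> dist_sum A K"
      unfolding dist_sum_def by (intro sum_mono le)
    ultimately have sums: "dist_sum A L = dist_sum A K" by simp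
    then have "hausdorff_dist L (A i) = hausdorff_dist K (A i)" for i
      using sum_mono_inv[of "\<lambda>i. hausdorff_dist L (A i)" UNIV "\<lambda>i. hausdorff_dist K (A i)" i] le
      by (simp add: dist_sum_def)
    then show ?thesis
      using sums \<open>L \<in> compacts\<close> K by (simp add: steiner_class_def steiner_compacts_def)
  qed
  then show ?thesis
    by (auto simp: steiner_class_def compacts_within_def steiner_compacts_def)
qed

lemma compact_chain_Inter_nonempty:
  fixes C :: "'a::t2_space set set"
  assumes "C \<noteq> {}" "\<And>S. S \<in> C \<Longrightarrow> compact S" "{} \<notin> C"
    and chain: "\<And>S T. S \<in> C \<Longrightarrow> T \<in> C \<Longrightarrow> S \<subseteq> T \<or> T \<subseteq> S"
  shows "\<Inter>C \<noteq> {}"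
proof -
  obtain S where S: "S \<in> C" using assms(1) by blast
  have "S \<inter> \<Inter>C \<noteq> {}"
  proof (rule compact_imp_fip)
    show "compact S" using S assms(2) by blast
    show "closed T" if "T \<in> C" for T using that assms(2) compact_imp_closed by blast
    fix F assume F: "finite F" "F \<subseteq> C"
    \<comment> \<open>A finite nonempty chain contains its own intersection.\<close>
    have "subset.chain C (insert S F)"
      using F S chain by (auto simp: subset_chain_def)
    then have "\<Inter>(insert S F) \<in> insert S F"
      using F by (intro Inter_in_chain) auto
    then show "S \<inter> \<Inter>F \<noteq> {}"
      using F S assms(3) by (metis Inter_insert insert_subset subsetD)
  qed
  then show ?thesis by blast
qed

text \<open>Both requirements of membership survive intersecting a chain: given a point \<open>a\<close> of some
  \<open>A i\<close>, the points of the members at distance at most \<open>d $ i\<close> from \<open>a\<close> again form a chain of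
  nonempty compact sets, and a common point of these witnesses the covering.\<close>

lemma (in compact_family) compacts_within_Inter_chain:
  assumes C: "C \<noteq> {}" "C \<subseteq> compacts_within A d"
    and chain: "\<And>S T. S \<in> C \<Longrightarrow> T \<in> C \<Longrightarrow> S \<subseteq> T \<or> T \<subseteq> S"
  shows "\<Inter>C \<in> compacts_within A d"
proof -
  have mem: "S \<in> compacts" "S \<subseteq> nbhd_inter A d" "\<And>i. A i \<subseteq> closed_nbhd (d $ i) S" if "S \<in> C" for S
    using that C(2) mem_compacts_within_iff[of S d] by blast+
  obtain S where S: "S \<in> C" using C by blast
  have "\<Inter>C \<noteq> {}"
  proof (rule compact_chain_Inter_nonempty)
    show "compact T" if "T \<in> C" for T using mem_compactsD(2)[OF mem(1)[OF that]] .
    show "{} \<notin> C" using mem(1) mem_compactsD(1) by blast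
  qed (use C chain in auto)
  moreover have "compact (\<Inter>C)"
    using S mem_compactsD(2,3)[OF mem(1)]
    by (metis Inter_lower closed_Inter compact_Int_closed inf.absorb_iff2)
  ultimately have Inter: "\<Inter>C \<in> compacts" by (simp add: compacts_def)
  moreover have "\<Inter>C \<subseteq> nbhd_inter A d" using S mem(2) by blast
  moreover have "a \<in> closed_nbhd (d $ i) (\<Inter>C)" if a: "a \<in> A i" for i a
  proof -
    let ?D = "(\<lambda>T. T \<inter> cball a (d $ i)) ` C"
    have "\<Inter>?D \<noteq> {}"
    proof (rule compact_chain_Inter_nonempty)
      show "?D \<noteq> {}" using C by simp
      show "compact T" if "T \<in> ?D" for T
        using that mem(1) mem_compactsD(2) by (auto intro: compact_Int_closed)
      have "T \<inter> cball a (d $ i) \<noteq> {}" if T: "T \<in> C" for T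
      proof -
        have "a \<in> closed_nbhd (d $ i) T" using mem(3)[OF T] a by blast
        then show ?thesis using mem_closed_nbhd_compact[OF mem(1)[OF T]] by auto
      qed
      then show "{} \<notin> ?D" by auto
      show "T \<subseteq> U \<or> U \<subseteq> T" if "T \<in> ?D" "U \<in> ?D" for T U
        using that chain by blast
    qed
    then obtain k where "k \<in> \<Inter>?D" by blast
    then have "k \<in> T \<inter> cball a (d $ i)" if "T \<in> C" for T using that by blast
    then have "k \<in> \<Inter>C" "dist a k \<le> d $ i" using S by auto
    then show ?thesis using mem_closed_nbhd_compact[OF Inter] by blast
  qed
  ultimately show ?thesis using mem_compacts_within_iff by blast
qed

lemma (in compact_family) compacts_within_minimal_subset:
  assumes K: "K \<in> compacts_within A d"
  shows "\<exists>M\<in>compacts_within A d. M \<subseteq> K \<and> (\<forall>L\<in>compacts_within A d. L \<subseteq> M \<longrightarrow> L = M)"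
proof -
  define W where "W = {L \<in> compacts_within A d. L \<subseteq> K}"
  have "\<exists>M\<in>W. \<forall>L\<in>W. M \<supseteq> L \<longrightarrow> L = M"
  proof (rule predicate_Zorn)
    show "partial_order_on W (relation_of (\<supseteq>) W)"
      by (intro partial_order_on_relation_ofI) auto
    fix C assume C: "C \<in> Chains (relation_of (\<supseteq>) W)"
    then have sub: "C \<subseteq> W" and chain: "\<And>S T. S \<in> C \<Longrightarrow> T \<in> C \<Longrightarrow> S \<subseteq> T \<or> T \<subseteq> S"
      by (auto simp: Chains_def relation_of_def)
    show "\<exists>U\<in>W. \<forall>S\<in>C. S \<supseteq> U"
    proof (cases "C = {}")
      case True
      then show ?thesis using K by (auto simp: W_def)
    next
      case False
      then have "\<Inter>C \<in> compacts_within A d"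
        using sub chain by (intro compacts_within_Inter_chain) (auto simp: W_def)
      moreover have "\<Inter>C \<subseteq> K" using False sub by (auto simp: W_def)
      ultimately show ?thesis by (auto simp: W_def)
    qed
  qed
  then obtain M where "M \<in> W" "\<And>L. L \<in> W \<Longrightarrow> L \<subseteq> M \<Longrightarrow> L = M" by blast
  then show ?thesis unfolding W_def by blast
qed

theorem theorem1:
  fixes A :: "'n::finite \<Rightarrow> 'a::metric_space set"
  assumes proper: "\<And>S :: 'a set. closed S \<Longrightarrow> bounded S \<Longrightarrow> compact S"
    and A: "\<And>i. A i \<in> compacts"
  shows "steiner_compacts A \<noteq> {} \<and> steiner_vectors A \<noteq> {} \<and>
    (\<forall>d \<in> steiner_vectors A.
      maximal_steiner A d (nbhd_inter A d) \<and>
      (\<forall>M. maximal_steiner A d M \<longrightarrow> M = nbhd_inter A d) \<and>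
      (\<forall>K. compact K \<longrightarrow>
        (K \<in> steiner_class A d \<longleftrightarrow>
          (\<exists>K\<^sub>0. minimal_steiner A d K\<^sub>0 \<and> K\<^sub>0 \<subseteq> K \<and> K \<subseteq> nbhd_inter A d))))"
proof -
  interpret proper_compact_family A
    by unfold_locales (use assms in auto)
  show ?thesis
  proof (intro conjI ballI)
    show "steiner_compacts A \<noteq> {}"
      by (rule steiner_compacts_nonempty)
    then show "steiner_vectors A \<noteq> {}" by (simp add: steiner_vectors_def)
    fix d assume d: "d \<in> steiner_vectors A"
    note cls = steiner_class_eq_compacts_within[OF d]
    have sub: "K \<subseteq> nbhd_inter A d" if "K \<in> steiner_class A d" for K
      using that cls mem_compacts_within_iff by blast
    have enlarge: "L \<in> steiner_class A d"
      if "K \<in> steiner_class A d" "K \<subseteq> L" "L \<subseteq> nbhd_inter A d" "compact L" for K L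
      using that compacts_within_enlarge cls by blast
    obtain K where "K \<in> steiner_class A d"
      using d unfolding steiner_vectors_def steiner_class_def by fastforce
    then have top: "nbhd_inter A d \<in> steiner_class A d"
      using enlarge sub compact_nbhd_inter by blast
    then show "maximal_steiner A d (nbhd_inter A d)"
      using sub by (auto simp: maximal_steiner_def)
    show "\<forall>M. maximal_steiner A d M \<longrightarrow> M = nbhd_inter A d"
      using sub top unfolding maximal_steiner_def by metis
    have minimal: "\<exists>M. minimal_steiner A d M \<and> M \<subseteq> K" if "K \<in> steiner_class A d" for K
    proof -
      obtain M where "M \<in> steiner_class A d" "M \<subseteq> K" "\<forall>L\<in>steiner_class A d. L \<subseteq> M \<longrightarrow> L = M"
        using compacts_within_minimal_subset[of K d] \<open>K \<in> steiner_class A d\<close> unfolding cls by auto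
      then show ?thesis by (auto simp: minimal_steiner_def)
    qed
    show "\<forall>K. compact K \<longrightarrow>
        (K \<in> steiner_class A d \<longleftrightarrow>
          (\<exists>K\<^sub>0. minimal_steiner A d K\<^sub>0 \<and> K\<^sub>0 \<subseteq> K \<and> K \<subseteq> nbhd_inter A d))"
    proof (intro allI impI iffI)
      fix K assume "K \<in> steiner_class A d"
      then show "\<exists>K\<^sub>0. minimal_steiner A d K\<^sub>0 \<and> K\<^sub>0 \<subseteq> K \<and> K \<subseteq> nbhd_inter A d"
        using minimal[of K] sub[of K] by auto
    next
      fix K assume "compact K"
        and "\<exists>K\<^sub>0. minimal_steiner A d K\<^sub>0 \<and> K\<^sub>0 \<subseteq> K \<and> K \<subseteq> nbhd_inter A d"
      then show "K \<in> steiner_class A d"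
        using enlarge[of _ K] by (auto simp: minimal_steiner_def)
    qed
  qed
qed

end
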